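(* Let $\mathfrak A$ be a finite-dimensional associative algebra over $\mathbb C$ of type 1, and let $F\in\mathfrak A^*$ be such that the pair $(\mathfrak A,F)$ is of type 1. Then $$\mathfrak A=\bigoplus_{\alpha\in\mathbb C\cup\{\infty\}}\ \bigcup_{k}V_k(\alpha).$$
   Context: Let $A_F$ be the matrix $(F(e_ie_j))_{i,j}$ in a basis $\{e_i\}$ of $\mathfrak A$. The pair $(\mathfrak A,F)$ is of type 1 if $\chi_F(\lambda,\mu)=\det(\lambda A_F+\mu A_F^T)$ is not the zero polynomial; $\mathfrak A$ is of type 1 if there is a non-empty open set (Zariski or Euclidean topology) of $F\in\mathfrak A^*$ with $(\mathfrak A,F)$ of type 1. The spaces $V_k(\alpha)$, depending on $F$, are defined as follows for $\alpha\in\mathbb C\cup\{\infty\}$. Set $V_0(\alpha)=\{0\}$. Fix a complex number $\alpha_0\neq\alpha$ (the resulting spaces do not depend on the choice of $\alpha_0$). For $k\ge0$ and $\alpha\ne\infty$, $$V_{k+1}(\alpha)=\{b\in\mathfrak A:\ \exists a\in V_k(\alpha)\ \forall x\in\mathfrak A:\ F(bx)-\alpha F(xb)=F(ax)-\alpha_0F(xa)\},$$ and $$V_{k+1}(\infty)=\{b\in\mathfrak A:\ \exists a\in V_k(\infty)\ \forall x\in\mathfrak A:\ F(xb)=F(ax)-\alpha_0F(xa)\}.$$ In particular $V_1(\alpha)=\mathrm{Stab}_F(\alpha)=\{a: F(ax)=\alpha F(xa)\ \forall x\}$ for $\alpha\neq\infty$ and $V_1(\infty)=\mathrm{Stab}_F(\infty)=\{a: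 F(xa)=0\ \forall x\}$. *)

theory Defs
  imports
    "HOL-Analysis.Function_Topology"
    "Jordan_Normal_Form.Determinant"
begin

datatype xcomplex = Fin complex | Infty

text \<open>
  The algebra is the whole type \<open>'a::ring\<close>, so it is associative but need not have a unit.
\<close>

locale fd_complex_algebra = vector_space scale
  for scale :: "complex \<Rightarrow> 'a::ring \<Rightarrow> 'a" (infixr "*\<^sub>C" 75) +
  assumes scale_mult_left: "(c *\<^sub>C x) * y = c *\<^sub>C (x * y)"
    and scale_mult_right: "x * (c *\<^sub>C y) = c *\<^sub>C (x * y)"
    and finite_dimensional: "\<exists>B. finite B \<and> span B = UNIV"

definition form_mat :: "'a::ring list \<Rightarrow> ('a \<Rightarrow> complex) \<Rightarrow> complex mat" where
  "form_mat e F = Matrix.mat (length e) (length e) (\<lambda>(i, j). F (e ! i * e ! j))"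

text \<open>
  The ring of polynomials in two variables \<open>\<lambda>\<close>, \<open>\<mu>\<close> is rendered as \<open>complex poly poly\<close>:
  \<open>\<lambda>\<close> is the outer variable \<open>[:0, 1:]\<close> and \<open>\<mu>\<close> is the inner one \<open>[:[:0, 1:]:]\<close>.
\<close>

definition char_form :: "'a::ring list \<Rightarrow> ('a \<Rightarrow> complex) \<Rightarrow> complex poly poly" where
  "char_form e F =
    (let A = map_mat (\<lambda>c. [:[:c:]:]) (form_mat e F)
     in Determinant.det ([:0, 1:] \<cdot>\<^sub>m A + [:[:0, 1:]:] \<cdot>\<^sub>m transpose_mat A))"

context fd_complex_algebra
begin

definition ordered_basis :: "'a list \<Rightarrow> bool" where
  "ordered_basis e \<longleftrightarrow> distinct e \<and> independent (set e) \<and> span (set e) = UNIV"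

definition dual :: "('a \<Rightarrow> complex) set" where
  "dual = {F. Vector_Spaces.linear scale (*) F}"

text \<open>
  A change of basis with matrix \<open>P\<close> multiplies \<open>char_form e F\<close> by the square of \<open>det P\<close>, so the
  choice of the basis does not matter.
\<close>

definition pair_type1 :: "('a \<Rightarrow> complex) \<Rightarrow> bool" where
  "pair_type1 F \<longleftrightarrow> (\<exists>e. ordered_basis e \<and> char_form e F \<noteq> 0)"

text \<open>
  The dual space carries the topology of pointwise convergence, inherited from the function type;
  since the algebra is finite-dimensional, this is the Euclidean topology. The Zariski topology
  would give the same notion: the coefficients of \<open>char_form e F\<close> are polynomials in the
  coordinates of \<open>F\<close>, so the functionals of type 1 form a Zariski open set.
\<close>

definition algebra_type1 :: bool where
  "algebra_type1 \<longleftrightarrow>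
    (\<exists>U. openin (top_of_set dual) U \<and> U \<noteq> {} \<and> (\<forall>F\<in>U. pair_type1 F))"

text \<open>The whole space is the internal direct sum of the family \<open>W\<close> of subspaces.\<close>

definition internal_direct_sum :: "('i \<Rightarrow> 'a set) \<Rightarrow> bool" where
  "internal_direct_sum W \<longleftrightarrow>
    (\<forall>i. subspace (W i)) \<and>
    (\<forall>x. \<exists>!v. (\<forall>i. v i \<in> W i) \<and> finite {i. v i \<noteq> 0} \<and> x = (\<Sum>i | v i \<noteq> 0. v i))"

end

text \<open>
  \<open>\<alpha>\<^sub>0\<close> is an auxiliary scalar, to be used with \<open>Fin \<alpha>\<^sub>0 \<noteq> \<alpha>\<close>.
\<close>

fun V :: "('a::ring \<Rightarrow> complex) \<Rightarrow> complex \<Rightarrow> xcomplex \<Rightarrow> nat \<Rightarrow> 'a set" where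
  "V F \<alpha>\<^sub>0 \<alpha> 0 = {0}"
| "V F \<alpha>\<^sub>0 (Fin \<alpha>) (Suc k) =
    {b. \<exists>a\<in>V F \<alpha>\<^sub>0 (Fin \<alpha>) k. \<forall>x. F (b * x) - \<alpha> * F (x * b) = F (a * x) - \<alpha>\<^sub>0 * F (x * a)}"
| "V F \<alpha>\<^sub>0 Infty (Suc k) =
    {b. \<exists>a\<in>V F \<alpha>\<^sub>0 Infty k. \<forall>x. F (x * b) = F (a * x) - \<alpha>\<^sub>0 * F (x * a)}"

end

theory Submission
  imports Defs "HOL-Computational_Algebra.Fundamental_Theorem_Algebra"
begin

text \<open>
  Write \<open>L a = F(a \<cdot>)\<close> and \<open>R a = F(\<cdot> a)\<close>, two linear maps from the algebra to its dual, and
  \<open>M \<alpha> = L - \<alpha> R\<close>, \<open>M \<infinity> = R\<close>. In coordinates \<open>l L + m R\<close> is the transpose of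
  \<open>l A + m A\<^sup>T\<close>, where \<open>A\<close> is the matrix of \<open>F\<close>. So, when \<open>char_form\<close> is not zero, some
  \<open>\<gamma> = - m / l\<close> makes \<open>N = M \<gamma>\<close> a bijection onto the dual
  (\<open>nonzero_bivariate_poly_value\<close>, \<open>pencil_unique_solution\<close>), and the pencil becomes the family of
  operators \<open>S \<alpha> = N\<inverse> M \<alpha>\<close> on the algebra.

  All that is needed about this family is that two distinct members are comaximal: \<open>M \<alpha>\<close> and
  \<open>M \<beta>\<close> span the pencil, so \<open>N = s M \<alpha> + t M \<beta>\<close>, that is, \<open>id = s S \<alpha> + t S \<beta>\<close>. It
  follows that the \<open>S \<alpha>\<close> commute, and that \<open>S \<alpha>\<close> acts bijectively on \<open>ker (S \<beta>)\<^sup>k\<close>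
  for \<open>\<alpha> \<noteq> \<beta>\<close>: modulo \<open>S \<alpha>\<close> the identity is a multiple of the nilpotent \<open>S \<beta>\<close>
  (\<open>S_surj_on_ker_pow\<close>, \<open>S_inj_on_gen_ker\<close>). The bijectivity has three uses.

  \<^item> The step from \<open>V\<^sub>k(\<alpha>)\<close> to \<open>V\<^sub>k\<^sub>+\<^sub>1(\<alpha>)\<close> reads \<open>S \<alpha> b \<in> S \<alpha>\<^sub>0 (V\<^sub>k(\<alpha>))\<close>; since
    \<open>S \<alpha>\<^sub>0\<close> permutes \<open>ker (S \<alpha>)\<^sup>k\<close>, induction gives \<open>V\<^sub>k(\<alpha>) = ker (S \<alpha>)\<^sup>k\<close>,
    whatever \<open>\<alpha>\<^sub>0 \<noteq> \<alpha>\<close> is (\<open>V_eq_ker_pow\<close>).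
  \<^item> The sum of the spaces \<open>\<Union>\<^sub>k ker (S \<alpha>)\<^sup>k\<close> is direct (\<open>gen_ker_independent\<close>): a power of
    \<open>S \<alpha>\<close> removes the component at \<open>\<alpha>\<close> from a relation and is injective on the others.
  \<^item> The sum \<open>W\<close> of these spaces contains \<open>x\<close> as soon as it contains \<open>S \<alpha> x\<close>
    (\<open>S_preimage_span_gen_ker\<close>). With \<open>T = S \<infinity>\<close>, every \<open>T - c\<close> is a nonzero multiple of
    some \<open>S \<alpha>\<close>. By finite dimension a nonzero polynomial in \<open>T\<close> annihilates \<open>x\<close>; over
    the complex numbers it splits into linear factors, which are stripped off one by one, from
    \<open>0 \<in> W\<close> up to \<open>x \<in> W\<close> (\<open>span_gen_ker_of_annihilated\<close>).

  The spaces are thus the generalised eigenspaces of \<open>T\<close>, labelled by the points of the projective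
  line other than \<open>\<gamma>\<close>; at \<open>\<gamma>\<close> itself \<open>S \<gamma> = id\<close> and the space is zero.
\<close>

section \<open>Polynomials in an operator\<close>

locale linear_operator = vector_space scale
  for scale :: "'a::field \<Rightarrow> 'b::ab_group_add \<Rightarrow> 'b" (infixr "*s" 75) +
  fixes T :: "'b \<Rightarrow> 'b"
  assumes linear_T: "Vector_Spaces.linear scale scale T"
begin

lemma linear_funpow: "Vector_Spaces.linear scale scale (T ^^ k)"
proof (induction k)
  case 0
  show ?case using linear_id by (simp add: id_def)
next
  case (Suc k)
  show ?case using Vector_Spaces.linear_compose[OF Suc linear_T] by (simp add: o_def)
qed

definition poly_apply :: "'a Polynomial.poly \<Rightarrow> 'b \<Rightarrow> 'b" where
  "poly_apply p x = (\<Sum>i\<le>Polynomial.degree p. scale (Polynomial.coeff p i) ((T ^^ i) x))"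

lemma poly_apply_bound:
  fixes p :: "'a Polynomial.poly"
  assumes "Polynomial.degree p \<le> n"
  shows "poly_apply p x = (\<Sum>i\<le>n. scale (Polynomial.coeff p i) ((T ^^ i) x))"
  unfolding poly_apply_def using assms
  by (intro sum.mono_neutral_left) (auto simp: Polynomial.coeff_eq_0)

lemma poly_apply_add: "poly_apply (p + q) x = poly_apply p x + poly_apply q x"
proof -
  define n where "n = max (Polynomial.degree p) (Polynomial.degree q)"
  have "Polynomial.degree (p + q) \<le> n" unfolding n_def by (rule degree_add_le_max)
  then show ?thesis
    by (simp add: poly_apply_bound[of _ n] n_def scale_left_distrib sum.distrib)
qed

lemma poly_apply_zero [simp]: "poly_apply 0 x = 0"
  by (simp add: poly_apply_def)

lemma poly_apply_sum: "poly_apply (\<Sum>i\<in>I. f i) x = (\<Sum>i\<in>I. poly_apply (f i) x)"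
  by (induction I rule: infinite_finite_induct) (simp_all add: poly_apply_add)

lemma poly_apply_monom: "poly_apply (Polynomial.monom c i) x = scale c ((T ^^ i) x)"
proof -
  have "poly_apply (Polynomial.monom c i) x
      = (\<Sum>j\<le>i. scale (Polynomial.coeff (Polynomial.monom c i) j) ((T ^^ j) x))"
    by (rule poly_apply_bound) (rule Polynomial.degree_monom_le)
  also have "\<dots> = (\<Sum>j\<in>{i}. scale (Polynomial.coeff (Polynomial.monom c i) j) ((T ^^ j) x))"
    by (rule sum.mono_neutral_right) auto
  finally show ?thesis by simp
qed

lemma poly_apply_linear_factor:
  "poly_apply ([:- c, 1:] * p) x = poly_apply p (T x - scale c x)"
proof -
  define n where "n = Polynomial.degree p"
  have pw: "(T ^^ i) (T x - scale c x) = (T ^^ Suc i) x - scale c ((T ^^ i) x)" for i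
  proof -
    interpret hi: Vector_Spaces.linear scale scale "T ^^ i" by (rule linear_funpow)
    show ?thesis by (simp add: hi.diff hi.scale funpow_swap1)
  qed
  have 1: "poly_apply (Polynomial.smult (- c) p) x = (\<Sum>i\<le>n. scale (- c * Polynomial.coeff p i) ((T ^^ i) x))"
    by (subst poly_apply_bound[of _ n]) (simp_all add: n_def Polynomial.degree_smult_le)
  have "poly_apply (pCons 0 p) x = (\<Sum>i\<le>Suc n. scale (Polynomial.coeff (pCons 0 p) i) ((T ^^ i) x))"
    by (rule poly_apply_bound) (simp add: n_def Polynomial.degree_pCons_le)
  also have "\<dots> = (\<Sum>i\<le>n. scale (Polynomial.coeff p i) ((T ^^ Suc i) x))"
    by (subst sum.atMost_Suc_shift) simp
  finally have 2: "poly_apply (pCons 0 p) x = (\<Sum>i\<le>n. scale (Polynomial.coeff p i) ((T ^^ Suc i) x))" .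
  have "poly_apply ([:- c, 1:] * p) x = poly_apply (Polynomial.smult (- c) p) x + poly_apply (pCons 0 p) x"
    by (simp add: poly_apply_add[symmetric])
  also have "\<dots> = (\<Sum>i\<le>n. scale (Polynomial.coeff p i) ((T ^^ i) (T x - scale c x)))"
    unfolding 1 2 sum.distrib[symmetric] pw
    by (intro sum.cong) (simp_all add: scale_right_diff_distrib mult.commute)
  finally show ?thesis by (simp add: poly_apply_def n_def)
qed

text \<open>
  More powers of \<open>T\<close> than the dimension, applied to \<open>x\<close>, cannot be independent. The vectors
  \<open>T\<^sup>i x\<close> are collected in a set, so a repetition among them has to be treated apart.
\<close>

lemma exists_annihilating_poly:
  assumes "finite B" "span B = UNIV"
  shows "\<exists>p. p \<noteq> 0 \<and> poly_apply p x = 0"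
proof (cases "inj (\<lambda>i. (T ^^ i) x)")
  case False
  then obtain i j where ij: "i \<noteq> j" "(T ^^ i) x = (T ^^ j) x" by (auto simp: inj_def)
  let ?p = "Polynomial.monom 1 i + Polynomial.monom (- 1) j :: 'a Polynomial.poly"
  have "Polynomial.coeff ?p i = 1" using ij by simp
  then have "?p \<noteq> 0" by (metis Polynomial.coeff_0 zero_neq_one)
  moreover have "poly_apply ?p x = 0" using ij by (simp add: poly_apply_add poly_apply_monom)
  ultimately show ?thesis by blast
next
  case True
  let ?f = "\<lambda>i. (T ^^ i) x"
  have "dependent (range ?f)"
    using independent_span_bound[OF assms(1), of "range ?f"] assms(2) range_inj_infinite[OF True]
    by auto
  then obtain U u v where U: "finite U" "U \<subseteq> range ?f" "(\<Sum>v\<in>U. scale (u v) v) = 0" "v \<in> U" "u v \<noteq> 0"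
    unfolding dependent_explicit by blast
  define I where "I = ?f -` U"
  have fin: "finite I" unfolding I_def by (rule finite_vimageI[OF U(1) True])
  have img: "?f ` I = U" using U(2) by (auto simp: I_def)
  define p where "p = (\<Sum>i\<in>I. Polynomial.monom (u (?f i)) i)"
  obtain m where m: "m \<in> I" "?f m = v" using img U(4) by auto
  have "Polynomial.coeff p m = u v"
    using m fin by (simp add: p_def Polynomial.coeff_sum)
  then have "p \<noteq> 0" using U(5) by auto
  moreover have "poly_apply p x = (\<Sum>i\<in>I. scale (u (?f i)) (?f i))"
    by (simp add: p_def poly_apply_sum poly_apply_monom)
  moreover have "\<dots> = (\<Sum>v\<in>U. scale (u v) v)"
    using sum.reindex[of ?f I "\<lambda>v. scale (u v) v"] inj_on_subset[OF True] img by (simp add: o_def)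
  ultimately show ?thesis using U(3) by auto
qed

end

section \<open>Generalised kernels in a comaximal family of operators\<close>

text \<open>
  The index type will be the projective line, and \<open>S\<close> a pencil of linear maps made into operators.
\<close>

locale comaximal_family = vector_space scale
  for scale :: "complex \<Rightarrow> 'a::ab_group_add \<Rightarrow> 'a" (infixr "*s" 75) +
  fixes S :: "'i \<Rightarrow> 'a \<Rightarrow> 'a"
  assumes linear_S: "Vector_Spaces.linear scale scale (S i)"
    and comaximal: "i \<noteq> j \<Longrightarrow> \<exists>s t. \<forall>x. x = s *s S i x + t *s S j x"
begin

lemma S_add: "S i (x + y) = S i x + S i y"
  and S_scale: "S i (c *s x) = c *s S i x"
  and S_zero: "S i 0 = 0"
  and S_diff: "S i (x - y) = S i x - S i y"
proof -
  interpret h: Vector_Spaces.linear scale scale "S i" by (rule linear_S)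
  show "S i (x + y) = S i x + S i y" by (rule h.add)
  show "S i (c *s x) = c *s S i x" by (rule h.scale)
  show "S i 0 = 0" by (rule h.zero)
  show "S i (x - y) = S i x - S i y" by (rule h.diff)
qed

lemma linear_S_funpow: "Vector_Spaces.linear scale scale (S i ^^ k)"
proof -
  interpret h: linear_operator scale "S i"
    by (intro linear_operator.intro linear_operator_axioms.intro vector_space_axioms linear_S)
  show ?thesis by (rule h.linear_funpow)
qed

text \<open>
  Apply \<open>id = s S\<^sub>i + t S\<^sub>j\<close> before and after \<open>S\<^sub>j\<close>, and compare: \<open>s\<close> kills the commutator.
  Likewise \<open>t\<close> does. If both scalars vanish then the identity is zero.
\<close>

lemma S_commute: "S i (S j x) = S j (S i x)"
proof (cases "i = j")
  case False
  then obtain s t where st: "\<And>x. x = s *s S i x + t *s S j x"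
    using comaximal by metis
  have "s *s S i (S j x) + t *s S j (S j x) = s *s S j (S i x) + t *s S j (S j x)"
    using st[of "S j x"] arg_cong[OF st[of x], of "S j"] by (simp add: S_add S_scale)
  moreover have "s *s S i (S i x) + t *s S j (S i x) = s *s S i (S i x) + t *s S i (S j x)"
    using st[of "S i x"] arg_cong[OF st[of x], of "S i"] by (simp add: S_add S_scale)
  ultimately have eqs: "s *s S i (S j x) = s *s S j (S i x)" "t *s S j (S i x) = t *s S i (S j x)"
    by simp_all
  show ?thesis
  proof (cases "s = 0 \<and> t = 0")
    case True
    then have "y = 0" for y :: 'a using st[of y] by simp
    then show ?thesis by metis
  next
    case False
    then show ?thesis using eqs by (auto simp: scale_cancel_left)
  qed
qed simp

lemma S_funpow_commute: "S i ((S j ^^ k) x) = (S j ^^ k) (S i x)"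
proof (induction k)
  case (Suc k)
  then show ?case using S_commute[of i j "(S j ^^ k) x"] by simp
qed simp

definition ker_pow :: "'i \<Rightarrow> nat \<Rightarrow> 'a set" where
  "ker_pow i k = {x. (S i ^^ k) x = 0}"

definition gen_ker :: "'i \<Rightarrow> 'a set" where
  "gen_ker i = (\<Union>k. ker_pow i k)"

lemma subspace_ker_pow: "subspace (ker_pow i k)"
proof -
  interpret h: Vector_Spaces.linear scale scale "S i ^^ k" by (rule linear_S_funpow)
  show ?thesis by (auto simp: ker_pow_def subspace_def h.add h.scale h.zero)
qed

lemma ker_pow_mono:
  assumes "k \<le> l"
  shows "ker_pow i k \<subseteq> ker_pow i l"
proof -
  have zero: "(S i ^^ m) 0 = 0" for m by (induction m) (simp_all add: S_zero)
  obtain d where "l = d + k" using assms le_Suc_ex by (metis add.commute)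
  then show ?thesis by (auto simp: ker_pow_def funpow_add zero)
qed

lemma subspace_gen_ker: "subspace (gen_ker i)"
proof (rule subspaceI)
  show "0 \<in> gen_ker i"
    using subspace_0[OF subspace_ker_pow] by (auto simp: gen_ker_def)
next
  fix x y assume "x \<in> gen_ker i" "y \<in> gen_ker i"
  then obtain k l where "x \<in> ker_pow i k" "y \<in> ker_pow i l" by (auto simp: gen_ker_def)
  then have "x \<in> ker_pow i (max k l)" "y \<in> ker_pow i (max k l)"
    using ker_pow_mono[of k "max k l" i] ker_pow_mono[of l "max k l" i] by auto
  then have "x + y \<in> ker_pow i (max k l)" by (rule subspace_add[OF subspace_ker_pow])
  then show "x + y \<in> gen_ker i" by (auto simp: gen_ker_def)
next
  fix c x assume "x \<in> gen_ker i"
  then show "c *s x \<in> gen_ker i"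
    unfolding gen_ker_def using subspace_scale[OF subspace_ker_pow] by blast
qed

lemma ker_pow_Suc_iff: "x \<in> ker_pow i (Suc k) \<longleftrightarrow> S i x \<in> ker_pow i k"
  by (simp add: ker_pow_def funpow_swap1)

lemma S_preimage_gen_ker: "S i x \<in> gen_ker i \<Longrightarrow> x \<in> gen_ker i"
  by (auto simp: gen_ker_def ker_pow_Suc_iff[symmetric])

lemma S_ker_pow: "x \<in> ker_pow j k \<Longrightarrow> S i x \<in> ker_pow j k"
  by (simp add: ker_pow_def S_funpow_commute[symmetric] S_zero)

lemma S_gen_ker: "x \<in> gen_ker j \<Longrightarrow> S i x \<in> gen_ker j"
  unfolding gen_ker_def using S_ker_pow by blast

lemma S_funpow_gen_ker: "x \<in> gen_ker j \<Longrightarrow> (S i ^^ k) x \<in> gen_ker j"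
  by (induction k) (simp_all add: S_gen_ker)

text \<open>
  Write \<open>x = s S\<^sub>i x + t S\<^sub>j x\<close>. The second summand lies one level lower in the filtration by
  \<open>ker S\<^sub>j\<^sup>k\<close>, so by induction it is in the image of \<open>S\<^sub>i\<close>, as the first one is.
\<close>

lemma S_surj_on_ker_pow:
  assumes "i \<noteq> j" "x \<in> ker_pow j k"
  shows "\<exists>y\<in>ker_pow j k. S i y = x"
proof -
  obtain s t where st: "\<And>x. x = s *s S i x + t *s S j x"
    using comaximal[OF \<open>i \<noteq> j\<close>] by metis
  show ?thesis using assms(2)
  proof (induction k arbitrary: x)
    case 0
    then show ?case by (auto simp: ker_pow_def S_zero)
  next
    case (Suc k)
    then obtain y where y: "y \<in> ker_pow j k" "S i y = S j x"
      unfolding ker_pow_Suc_iff by blast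
    have "y \<in> ker_pow j (Suc k)" using y(1) ker_pow_mono[of k "Suc k"] by auto
    then have "s *s x + t *s y \<in> ker_pow j (Suc k)"
      using Suc.prems by (intro subspace_add subspace_scale subspace_ker_pow)
    moreover have "S i (s *s x + t *s y) = x"
      using st[of x] by (simp add: S_add S_scale y(2))
    ultimately show ?case by blast
  qed
qed

text \<open>
  On the kernel of \<open>S\<^sub>i\<close> the identity is \<open>t S\<^sub>j\<close>, which is nilpotent at \<open>x\<close>.
\<close>

lemma S_inj_on_gen_ker:
  assumes "i \<noteq> j" "x \<in> gen_ker j" "S i x = 0"
  shows "x = 0"
proof -
  obtain s t where st: "\<And>x. x = s *s S i x + t *s S j x"
    using comaximal[OF \<open>i \<noteq> j\<close>] by metis
  obtain k where "x \<in> ker_pow j k" using assms(2) by (auto simp: gen_ker_def)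
  then show ?thesis using assms(3)
  proof (induction k arbitrary: x)
    case 0
    then show ?case by (simp add: ker_pow_def)
  next
    case (Suc k)
    have "S j x = 0"
    proof (rule Suc.IH)
      show "S j x \<in> ker_pow j k" using Suc.prems(1) by (simp only: ker_pow_Suc_iff)
      show "S i (S j x) = 0" using Suc.prems(2) by (simp only: S_commute[of i j] S_zero)
    qed
    then show ?case using st[of x] Suc.prems(2) by simp
  qed
qed

lemma S_funpow_inj_on_gen_ker:
  assumes "i \<noteq> j" "x \<in> gen_ker j" "(S i ^^ k) x = 0"
  shows "x = 0"
  using assms(2,3)
proof (induction k arbitrary: x)
  case (Suc k)
  have "(S i ^^ k) (S i x) = 0" using Suc.prems(2) by (simp add: funpow_swap1)
  then have "S i x = 0" by (rule Suc.IH[OF S_gen_ker[OF Suc.prems(1)]])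
  then show ?case using S_inj_on_gen_ker[OF assms(1)] Suc.prems by blast
qed simp

text \<open>
  A power of \<open>S\<^sub>j\<close> that kills \<open>v j\<close> shortens the relation, leaves the other terms in their
  spaces and kills none of them unless it is zero already.
\<close>

lemma gen_ker_independent:
  assumes "finite A" "\<And>i. i \<in> A \<Longrightarrow> v i \<in> gen_ker i" "(\<Sum>i\<in>A. v i) = 0" "i \<in> A"
  shows "v i = 0"
  using assms
proof (induction A arbitrary: v i rule: finite_induct)
  case (insert j A)
  obtain k where k: "(S j ^^ k) (v j) = 0"
    using insert.prems(1)[of j] by (auto simp: gen_ker_def ker_pow_def)
  interpret h: Vector_Spaces.linear scale scale "S j ^^ k" by (rule linear_S_funpow)
  have "(S j ^^ k) (v j) + (\<Sum>i\<in>A. (S j ^^ k) (v i)) = 0"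
    using arg_cong[OF insert.prems(2), of "S j ^^ k"] insert.hyps
    by (simp add: h.add h.sum h.zero)
  then have sum0: "(\<Sum>i\<in>A. (S j ^^ k) (v i)) = 0" using k by simp
  have vA: "v i = 0" if "i \<in> A" for i
  proof -
    have ne: "j \<noteq> i" using that insert.hyps by auto
    have pw: "(S j ^^ k) (v i) = 0"
      using insert.IH[of "\<lambda>i. (S j ^^ k) (v i)"] sum0 that insert.prems(1) S_funpow_gen_ker by blast
    show ?thesis using S_funpow_inj_on_gen_ker[OF ne _ pw] insert.prems(1) that by blast
  qed
  have "v j = 0" using insert.prems(2) insert.hyps vA by simp
  then show ?case using vA insert.prems(3) by auto
qed simp

text \<open>
  This lets linear factors be stripped off an annihilating polynomial. A component of \<open>S\<^sub>i x\<close> at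
  \<open>j \<noteq> i\<close> can be pulled back along \<open>S\<^sub>i\<close> inside its own space. After subtraction of these
  preimages from \<open>x\<close> only the component at \<open>i\<close> is left, and \<open>gen_ker i\<close> is closed under preimages.
\<close>

lemma S_preimage_span_gen_ker:
  assumes "S i x \<in> span (\<Union>j. gen_ker j)"
  shows "x \<in> span (\<Union>j. gen_ker j)" (is "_ \<in> ?W")
proof -
  have "\<exists>z\<in>?W. y - S i z \<in> gen_ker i" if "y \<in> ?W" for y
    using that
  proof (induction rule: span_induct_alt)
    case base
    then show ?case
      by (intro bexI[of _ 0]) (auto simp: S_zero span_zero subspace_0 subspace_gen_ker)
  next
    case (step c w y)
    then obtain z where z: "z \<in> ?W" "y - S i z \<in> gen_ker i" by blast
    obtain j where j: "w \<in> gen_ker j" using step by blast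
    have "\<exists>z'\<in>?W. w - S i z' \<in> gen_ker i"
    proof (cases "j = i")
      case True
      then show ?thesis using j by (intro bexI[of _ 0]) (auto simp: S_zero span_zero)
    next
      case False
      obtain k where "w \<in> ker_pow j k" using j by (auto simp: gen_ker_def)
      then obtain z' where z': "z' \<in> ker_pow j k" "S i z' = w"
        using S_surj_on_ker_pow[of i j w k] False by auto
      then have "z' \<in> ?W" by (intro span_base) (auto simp: gen_ker_def)
      then show ?thesis using z'(2) subspace_0[OF subspace_gen_ker] by (intro bexI[of _ z']) auto
    qed
    then obtain z' where z': "z' \<in> ?W" "w - S i z' \<in> gen_ker i" by blast
    have "c *s w + y - S i (c *s z' + z) = c *s (w - S i z') + (y - S i z)"
      by (simp add: S_add S_scale scale_right_diff_distrib)
    then have "c *s w + y - S i (c *s z' + z) \<in> gen_ker i"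
      using z z' by (simp only: subspace_add subspace_scale subspace_gen_ker)
    then show ?case using z z' by (meson span_add span_scale)
  qed
  then obtain z where z: "z \<in> ?W" "S i x - S i z \<in> gen_ker i" using assms by blast
  then have "x - z \<in> gen_ker i" using S_preimage_gen_ker by (simp add: S_diff)
  then have "x - z \<in> ?W" by (intro span_base) auto
  then show ?thesis using z(1) span_add[of "x - z" _ z] by simp
qed

end

section \<open>The direct sum decomposition\<close>

text \<open>
  The assumption \<open>shift\<close> says that the family has a member for each possible eigenvalue \<open>c\<close> of \<open>T\<close>,
  so that it detects all of them.
\<close>

locale full_comaximal_family = comaximal_family scale S + linear_operator scale T
  for scale :: "complex \<Rightarrow> 'a::ab_group_add \<Rightarrow> 'a" (infixr "*s" 75)
    and S :: "'i \<Rightarrow> 'a \<Rightarrow> 'a"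
    and T :: "'a \<Rightarrow> 'a" +
  assumes shift: "\<exists>i u. u \<noteq> 0 \<and> (\<forall>x. T x - c *s x = u *s S i x)"
    and finite_span: "\<exists>B. finite B \<and> span B = UNIV"
begin

lemma span_gen_ker_of_annihilated:
  assumes "p \<noteq> 0" "poly_apply p x = 0"
  shows "x \<in> span (\<Union>i. gen_ker i)"
  using assms
proof (induction "Polynomial.degree p" arbitrary: p x)
  case 0
  then obtain a where "p = [:a:]" by (metis degree_eq_zeroE)
  then have "x = 0" using 0 by (simp add: poly_apply_def)
  then show ?case by (simp add: span_zero)
next
  case (Suc n)
  have "\<not> constant (Polynomial.poly p)" using Suc.hyps(2) by (simp add: constant_degree)
  then obtain c where "Polynomial.poly p c = 0" using fundamental_theorem_of_algebra by blast
  then obtain q where q: "p = [:- c, 1:] * q" by (auto simp: poly_eq_0_iff_dvd)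
  have "q \<noteq> 0" using q Suc.prems by auto
  then have "Polynomial.degree p = Suc (Polynomial.degree q)"
    unfolding q by (subst Polynomial.degree_mult_eq) auto
  then have step: "T x - c *s x \<in> span (\<Union>i. gen_ker i)"
    using Suc.hyps(2) Suc.prems(2) \<open>q \<noteq> 0\<close> unfolding q poly_apply_linear_factor
    by (intro Suc.hyps(1)[of q]) simp_all
  obtain i u where u: "u \<noteq> 0" "\<And>x. T x - c *s x = u *s S i x" using shift by blast
  have "inverse u *s (T x - c *s x) \<in> span (\<Union>i. gen_ker i)" using step by (rule span_scale)
  then have "S i x \<in> span (\<Union>i. gen_ker i)" using u by simp
  then show ?case by (rule S_preimage_span_gen_ker)
qed

lemma span_gen_ker: "span (\<Union>i. gen_ker i) = UNIV"
proof -
  obtain B where B: "finite B" "span B = UNIV" using finite_span by blast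
  have "x \<in> span (\<Union>i. gen_ker i)" for x
    using exists_annihilating_poly[OF B, of x] span_gen_ker_of_annihilated by blast
  then show ?thesis by blast
qed

theorem gen_ker_decomposition:
  "\<exists>!v. (\<forall>i. v i \<in> gen_ker i) \<and> finite {i. v i \<noteq> 0} \<and> x = (\<Sum>i | v i \<noteq> 0. v i)"
proof -
  let ?D = "\<lambda>x v. (\<forall>i. v i \<in> gen_ker i) \<and> finite {i. v i \<noteq> 0} \<and> x = (\<Sum>i | v i \<noteq> 0. v i)"
  have support: "(\<Sum>i | v i \<noteq> 0. v i) = (\<Sum>i\<in>A. v i)"
    if "finite A" "{i. v i \<noteq> 0} \<subseteq> A" for A and v :: "'i \<Rightarrow> 'a"
    using that by (intro sum.mono_neutral_left) auto
  have "x \<in> span (\<Union>i. gen_ker i)" by (simp add: span_gen_ker)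
  then have "\<exists>v. ?D x v"
  proof (induction rule: span_induct_alt)
    case base
    show ?case by (intro exI[of _ "\<lambda>_. 0"]) (simp add: subspace_0 subspace_gen_ker)
  next
    case (step c w y)
    then obtain v j where v: "\<And>i. v i \<in> gen_ker i" "finite {i. v i \<noteq> 0}" "y = (\<Sum>i | v i \<noteq> 0. v i)"
      and j: "w \<in> gen_ker j" by blast
    (* Only the component at j changes; it may become zero, so the support may shrink. *)
    let ?v = "v(j := c *s w + v j)" and ?A = "insert j {i. v i \<noteq> 0}"
    have sub: "{i. ?v i \<noteq> 0} \<subseteq> ?A" by auto
    have "\<forall>i. ?v i \<in> gen_ker i" using v(1) j by (auto intro: subspace_add subspace_scale subspace_gen_ker)
    moreover have "finite {i. ?v i \<noteq> 0}" using finite_subset[OF sub] v(2) by simp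
    moreover have "c *s w + y = (\<Sum>i | ?v i \<noteq> 0. ?v i)"
    proof -
      have "y = (\<Sum>i\<in>?A. v i)" unfolding v(3) using v(2) by (intro support) auto
      also have "\<dots> = v j + (\<Sum>i\<in>?A - {j}. v i)" using v(2) by (intro sum.remove) auto
      finally have y: "y = v j + (\<Sum>i\<in>?A - {j}. v i)" .
      have "(\<Sum>i | ?v i \<noteq> 0. ?v i) = (\<Sum>i\<in>?A. ?v i)" using v(2) by (intro support sub) auto
      also have "\<dots> = ?v j + (\<Sum>i\<in>?A - {j}. ?v i)" using v(2) by (intro sum.remove) auto
      also have "(\<Sum>i\<in>?A - {j}. ?v i) = (\<Sum>i\<in>?A - {j}. v i)" by (intro sum.cong) auto
      finally show ?thesis using y by simp
    qed
    ultimately show ?case by blast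
  qed
  moreover have "v = w" if v: "?D x v" and w: "?D x w" for v w
  proof
    fix i
    let ?A = "insert i ({i. v i \<noteq> 0} \<union> {i. w i \<noteq> 0})"
    have fin: "finite ?A" using v w by simp
    have "x = (\<Sum>i\<in>?A. v i)" using support[OF fin, of v] v by blast
    moreover have "x = (\<Sum>i\<in>?A. w i)" using support[OF fin, of w] w by blast
    ultimately have "(\<Sum>i\<in>?A. v i - w i) = 0" by (simp add: sum_subtractf)
    then have "v i - w i = 0"
      using gen_ker_independent[OF fin, of "\<lambda>i. v i - w i"] v w
      by (auto intro: subspace_diff subspace_gen_ker)
    then show "v i = w i" by simp
  qed
  ultimately show ?thesis by blast
qed

end

section \<open>The pencil of a functional on an algebra\<close>

locale algebra_functional = fd_complex_algebra scale
  for scale :: "complex \<Rightarrow> 'a::ring \<Rightarrow> 'a" (infixr "*\<^sub>C" 75) +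
  fixes F :: "'a \<Rightarrow> complex"
  assumes F_dual: "F \<in> dual"
begin

lemma dual_iff: "\<phi> \<in> dual \<longleftrightarrow> (\<forall>x y. \<phi> (x + y) = \<phi> x + \<phi> y) \<and> (\<forall>c x. \<phi> (c *\<^sub>C x) = c * \<phi> x)"
proof -
  have "vector_space ((*) :: complex \<Rightarrow> complex \<Rightarrow> complex)"
    by unfold_locales (simp_all add: algebra_simps)
  then show ?thesis
    using vector_space_axioms
    by (auto simp: dual_def Vector_Spaces.linear_iff)
qed

lemma F_add: "F (x + y) = F x + F y" and F_scale: "F (c *\<^sub>C x) = c * F x"
  using F_dual by (auto simp: dual_iff)

fun pencil :: "xcomplex \<Rightarrow> 'a \<Rightarrow> 'a \<Rightarrow> complex" where
  "pencil (Fin \<alpha>) a x = F (a * x) - \<alpha> * F (x * a)"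
| "pencil Infty a x = F (x * a)"

lemma V_Suc_iff:
  "b \<in> V F \<alpha>\<^sub>0 \<alpha> (Suc k) \<longleftrightarrow> (\<exists>a\<in>V F \<alpha>\<^sub>0 \<alpha> k. pencil \<alpha> b = pencil (Fin \<alpha>\<^sub>0) a)"
  by (cases \<alpha>) (auto simp: fun_eq_iff)

lemma pencil_add: "pencil \<alpha> (a + b) x = pencil \<alpha> a x + pencil \<alpha> b x"
  by (cases \<alpha>) (simp_all add: F_add algebra_simps)

lemma pencil_scale: "pencil \<alpha> (c *\<^sub>C a) x = c * pencil \<alpha> a x"
  by (cases \<alpha>) (simp_all add: F_scale scale_mult_left scale_mult_right algebra_simps)

lemma pencil_dual: "pencil \<alpha> a \<in> dual"
  by (cases \<alpha>)
    (simp_all add: dual_iff F_add F_scale scale_mult_left scale_mult_right algebra_simps)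

lemma basis_expansion:
  assumes "distinct e" "span (set e) = UNIV"
  shows "\<exists>c. x = (\<Sum>i<length e. c i *\<^sub>C e ! i)"
proof -
  obtain u where "x = (\<Sum>v\<in>set e. u v *\<^sub>C v)"
    using span_finite[of "set e"] assms(2) by auto
  also have "\<dots> = (\<Sum>i<length e. u (e ! i) *\<^sub>C e ! i)"
    using sum.reindex_bij_betw[OF bij_betw_nth[OF assms(1) refl refl], of "\<lambda>v. u v *\<^sub>C v"] by simp
  finally show ?thesis by (intro exI[of _ "\<lambda>i. u (e ! i)"])
qed

lemma dual_sum:
  assumes "\<phi> \<in> dual"
  shows "\<phi> (\<Sum>i\<in>I. c i *\<^sub>C v i) = (\<Sum>i\<in>I. c i * \<phi> (v i))"
proof -
  have "\<phi> 0 = 0" using assms[unfolded dual_iff] by (metis add_cancel_right_left add.right_neutral)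
  then show ?thesis using assms
    by (induction I rule: infinite_finite_induct) (auto simp: dual_iff)
qed

lemma dual_eqI:
  assumes "distinct e" "span (set e) = UNIV" "\<phi> \<in> dual" "\<psi> \<in> dual"
    and "\<And>j. j < length e \<Longrightarrow> \<phi> (e ! j) = \<psi> (e ! j)"
  shows "\<phi> = \<psi>"
proof
  fix x
  obtain c where "x = (\<Sum>i<length e. c i *\<^sub>C e ! i)" using basis_expansion assms(1,2) by blast
  then show "\<phi> x = \<psi> x" using assms(3-5) by (simp add: dual_sum)
qed

text \<open>
  For \<open>a = \<Sum>\<^sub>i c\<^sub>i e\<^sub>i\<close>, the values of \<open>l F(a \<cdot>) + m F(\<cdot> a)\<close> on the basis are the entries of
  \<open>B c\<close>, where \<open>B\<close> is the transpose of \<open>l A + m A\<^sup>T\<close>. Hence the equation for \<open>a\<close> is a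
  linear system with an invertible matrix.
\<close>

lemma pencil_unique_solution:
  assumes e: "distinct e" "span (set e) = UNIV" and l: "l \<noteq> 0"
    and det: "Determinant.det (l \<cdot>\<^sub>m form_mat e F + m \<cdot>\<^sub>m transpose_mat (form_mat e F)) \<noteq> 0"
    and \<phi>: "\<phi> \<in> dual"
  shows "\<exists>!a. pencil (Fin (- m / l)) a = \<phi>"
proof -
  define n where "n = length e"
  define B where "B = transpose_mat (l \<cdot>\<^sub>m form_mat e F + m \<cdot>\<^sub>m transpose_mat (form_mat e F))"
  have A: "form_mat e F \<in> carrier_mat n n" by (simp add: form_mat_def n_def)
  have B: "B \<in> carrier_mat n n" using A by (auto simp: B_def)
  have detB: "Determinant.det B \<noteq> 0"
    using det A unfolding B_def by (subst det_transpose) auto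
  let ?comb = "\<lambda>c. \<Sum>i<n. c i *\<^sub>C e ! i"
  have mult: "(B *\<^sub>v Matrix.vec n c) $ j = l * pencil (Fin (- m / l)) (?comb c) (e ! j)"
    if "j < n" for c j
  proof -
    have lin: "(\<lambda>a. l * pencil (Fin (- m / l)) a (e ! j)) \<in> dual"
      by (simp only: dual_iff pencil_add pencil_scale) (simp add: algebra_simps)
    have "(B *\<^sub>v Matrix.vec n c) $ j = (\<Sum>i<n. B $$ (j, i) * c i)"
      using B that by (simp add: scalar_prod_def atLeast0LessThan)
    also have "\<dots> = (\<Sum>i<n. c i * (l * pencil (Fin (- m / l)) (e ! i) (e ! j)))"
      using that l by (intro sum.cong)
        (auto simp: B_def form_mat_def n_def field_simps)
    finally show ?thesis using dual_sum[OF lin, of c "(!) e" "{..<n}"] by simp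
  qed
  obtain C where C: "C \<in> carrier_mat n n" "B * C = 1\<^sub>m n" "C * B = 1\<^sub>m n"
    using det_non_zero_imp_unit[OF B detB, of n] by (auto simp: Units_def ring_mat_simps)
  have sol: "pencil (Fin (- m / l)) (?comb c) = \<phi> \<longleftrightarrow>
      Matrix.vec n c = C *\<^sub>v Matrix.vec n (\<lambda>j. l * \<phi> (e ! j))" (is "_ \<longleftrightarrow> _ = C *\<^sub>v ?r") for c
  proof -
    have "pencil (Fin (- m / l)) (?comb c) = \<phi> \<longleftrightarrow>
        (\<forall>j<n. pencil (Fin (- m / l)) (?comb c) (e ! j) = \<phi> (e ! j))"
      using dual_eqI[OF e pencil_dual \<phi>] n_def by auto
    also have "\<dots> \<longleftrightarrow> B *\<^sub>v Matrix.vec n c = ?r"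
      using B l mult by (auto simp: vec_eq_iff)
    also have "\<dots> \<longleftrightarrow> Matrix.vec n c = C *\<^sub>v ?r"
    proof
      assume "B *\<^sub>v Matrix.vec n c = ?r"
      then have "C *\<^sub>v ?r = (C * B) *\<^sub>v Matrix.vec n c"
        using assoc_mult_mat_vec[OF C(1) B, of "Matrix.vec n c"] by simp
      then show "Matrix.vec n c = C *\<^sub>v ?r" using C by simp
    next
      assume "Matrix.vec n c = C *\<^sub>v ?r"
      then have "B *\<^sub>v Matrix.vec n c = (B * C) *\<^sub>v ?r"
        using assoc_mult_mat_vec[OF B C(1), of ?r] by simp
      then show "B *\<^sub>v Matrix.vec n c = ?r" using C by simp
    qed
    finally show ?thesis .
  qed
  show ?thesis
  proof
    have "Matrix.vec n (\<lambda>i. (C *\<^sub>v Matrix.vec n (\<lambda>j. l * \<phi> (e ! j))) $ i)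
        = C *\<^sub>v Matrix.vec n (\<lambda>j. l * \<phi> (e ! j))"
      using C by (auto simp: vec_eq_iff)
    then show "pencil (Fin (- m / l)) (?comb (\<lambda>i. (C *\<^sub>v Matrix.vec n (\<lambda>j. l * \<phi> (e ! j))) $ i)) = \<phi>"
      by (simp only: sol)
  next
    fix a assume a: "pencil (Fin (- m / l)) a = \<phi>"
    obtain c where c: "a = ?comb c" using basis_expansion[OF e] n_def by blast
    then have "Matrix.vec n c = C *\<^sub>v Matrix.vec n (\<lambda>j. l * \<phi> (e ! j))" using a sol by simp
    then have "c i = (C *\<^sub>v Matrix.vec n (\<lambda>j. l * \<phi> (e ! j))) $ i" if "i < n" for i
      using that by (metis index_vec)
    then show "a = ?comb (\<lambda>i. (C *\<^sub>v Matrix.vec n (\<lambda>j. l * \<phi> (e ! j))) $ i)"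
      unfolding c by (intro sum.cong) auto
  qed
qed

end

text \<open>
  The point is that \<open>l\<close> can be taken nonzero, so that the invertible member of the pencil lies at
  the finite parameter \<open>- m / l\<close>: only finitely many values of the outer variable make the
  polynomial vanish identically in the inner one, and \<open>0\<close> can be excluded with them.
\<close>

lemma nonzero_bivariate_poly_value:
  fixes p :: "complex Polynomial.poly Polynomial.poly"
  assumes "p \<noteq> 0"
  shows "\<exists>l m. l \<noteq> 0 \<and> Polynomial.poly (Polynomial.poly p [:l:]) m \<noteq> 0"
proof -
  have "finite {l. Polynomial.poly p [:l:] = 0}"
    using finite_vimageI[OF poly_roots_finite[OF assms], of "\<lambda>l. [:l:]"]
    by (auto simp: vimage_def inj_def)
  then have "finite (insert 0 {l. Polynomial.poly p [:l:] = 0})" by simp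
  then obtain l where "l \<notin> insert 0 {l. Polynomial.poly p [:l:] = 0}"
    using ex_new_if_finite[OF infinite_UNIV_char_0] by blast
  then have l: "l \<noteq> 0" "Polynomial.poly p [:l:] \<noteq> 0" by auto
  then obtain m where "Polynomial.poly (Polynomial.poly p [:l:]) m \<noteq> 0"
    using poly_all_0_iff_0 by blast
  then show ?thesis using l by blast
qed

lemma poly_char_form:
  "Polynomial.poly (Polynomial.poly (char_form e F) [:l:]) m
    = Determinant.det (l \<cdot>\<^sub>m form_mat e F + m \<cdot>\<^sub>m transpose_mat (form_mat e F))"
proof -
  interpret h: comm_ring_hom "\<lambda>p. Polynomial.poly (Polynomial.poly p [:l:]) m"
    by unfold_locales auto
  show ?thesis
    unfolding char_form_def Let_def h.hom_det[symmetric]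
    by (intro arg_cong[of _ _ Determinant.det] eq_matI) (auto simp: form_mat_def)
qed

locale regular_functional = algebra_functional scale F
  for scale :: "complex \<Rightarrow> 'a::ring \<Rightarrow> 'a" (infixr "*\<^sub>C" 75) and F +
  fixes \<gamma> :: complex
  assumes regular: "\<phi> \<in> dual \<Longrightarrow> \<exists>!a. pencil (Fin \<gamma>) a = \<phi>"
begin

text \<open>
  The operator \<open>N\<inverse> M \<alpha>\<close>, where \<open>M \<alpha>\<close> is \<open>pencil \<alpha>\<close> and \<open>N\<close> is \<open>pencil (Fin \<gamma>)\<close>.
\<close>

definition pencil_op :: "xcomplex \<Rightarrow> 'a \<Rightarrow> 'a" where
  "pencil_op \<alpha> b = (THE a. pencil (Fin \<gamma>) a = pencil \<alpha> b)"

lemma pencil_pencil_op: "pencil (Fin \<gamma>) (pencil_op \<alpha> b) = pencil \<alpha> b"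
  unfolding pencil_op_def by (rule theI'[OF regular[OF pencil_dual]])

lemma pencil_inj: "pencil (Fin \<gamma>) a = pencil (Fin \<gamma>) b \<longleftrightarrow> a = b"
  using regular[OF pencil_dual] by blast

lemma pencil_op_eq_iff: "pencil_op \<alpha> a = pencil_op \<beta> b \<longleftrightarrow> pencil \<alpha> a = pencil \<beta> b"
  using pencil_inj[of "pencil_op \<alpha> a" "pencil_op \<beta> b"] by (simp only: pencil_pencil_op)

lemma pencil_pencil_op': "pencil (Fin \<gamma>) (pencil_op \<alpha> b) x = pencil \<alpha> b x"
  by (simp only: pencil_pencil_op)

lemma pencil_op_add: "pencil_op \<alpha> (a + b) = pencil_op \<alpha> a + pencil_op \<alpha> b"
  unfolding pencil_inj[symmetric] fun_eq_iff by (simp only: pencil_add pencil_pencil_op') simp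

lemma pencil_op_scale: "pencil_op \<alpha> (c *\<^sub>C a) = c *\<^sub>C pencil_op \<alpha> a"
  unfolding pencil_inj[symmetric] fun_eq_iff by (simp only: pencil_scale pencil_pencil_op') simp

text \<open>
  Two distinct points of the projective line span the plane, so the member of the pencil at \<open>\<gamma>\<close> is
  a combination of those at \<open>\<alpha>\<close> and \<open>\<beta>\<close>.
\<close>

lemma pencil_op_comaximal:
  assumes "\<alpha> \<noteq> \<beta>"
  shows "\<exists>s t. \<forall>x. x = s *\<^sub>C pencil_op \<alpha> x + t *\<^sub>C pencil_op \<beta> x"
proof -
  have *: "\<exists>s t. \<forall>a x. pencil (Fin \<gamma>) a x = s * pencil \<alpha> a x + t * pencil \<beta> a x"
  proof (cases \<alpha>; cases \<beta>)
    fix a b assume ab: "\<alpha> = Fin a" "\<beta> = Fin b"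
    then have "a - b \<noteq> 0" using assms by auto
    then have "pencil (Fin \<gamma>) c x
        = (\<gamma> - b) / (a - b) * pencil \<alpha> c x + (a - \<gamma>) / (a - b) * pencil \<beta> c x" for c x
      unfolding ab pencil.simps by (simp add: divide_simps) (simp add: algebra_simps)
    then show ?thesis by blast
  next
    fix a assume "\<alpha> = Fin a" "\<beta> = Infty"
    then have "pencil (Fin \<gamma>) c x = 1 * pencil \<alpha> c x + (a - \<gamma>) * pencil \<beta> c x" for c x
      by (simp add: algebra_simps)
    then show ?thesis by blast
  next
    fix b assume "\<alpha> = Infty" "\<beta> = Fin b"
    then have "pencil (Fin \<gamma>) c x = (b - \<gamma>) * pencil \<alpha> c x + 1 * pencil \<beta> c x" for c x
      by (simp add: algebra_simps)
    then show ?thesis by blast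
  qed (use assms in auto)
  then obtain s t where "\<And>a x. pencil (Fin \<gamma>) a x = s * pencil \<alpha> a x + t * pencil \<beta> a x" by blast
  then have "a = s *\<^sub>C pencil_op \<alpha> a + t *\<^sub>C pencil_op \<beta> a" for a
    unfolding pencil_inj[symmetric] fun_eq_iff pencil_add pencil_scale pencil_pencil_op' by blast
  then show ?thesis by blast
qed

text \<open>
  From \<open>R - c N = - c (L - (\<gamma> + 1 / c) R)\<close> the parameter for \<open>c \<noteq> 0\<close> is \<open>\<gamma> + 1 / c\<close>.
\<close>

lemma pencil_op_shift:
  "\<exists>\<alpha> u. u \<noteq> 0 \<and> (\<forall>x. pencil_op Infty x - c *\<^sub>C x = u *\<^sub>C pencil_op \<alpha> x)"
proof (cases "c = 0")
  case True
  then show ?thesis by (intro exI[of _ Infty] exI[of _ 1]) simp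
next
  case False
  have "pencil_op Infty x + (- c) *\<^sub>C x = (- c) *\<^sub>C pencil_op (Fin (\<gamma> + 1 / c)) x" for x
    unfolding pencil_inj[symmetric] fun_eq_iff pencil_add pencil_scale pencil_pencil_op'
    using False by (simp add: field_simps)
  then show ?thesis using False by (intro exI[of _ "Fin (\<gamma> + 1 / c)"] exI[of _ "- c"]) simp
qed

sublocale ops: full_comaximal_family scale pencil_op "pencil_op Infty"
  by unfold_locales
    (fact pencil_op_add pencil_op_scale pencil_op_comaximal pencil_op_shift finite_dimensional)+

text \<open>
  Composition with \<open>N\<inverse>\<close> turns the recursive condition on \<open>b\<close> into
  \<open>S \<alpha> b \<in> S \<alpha>\<^sub>0 (ker (S \<alpha>)\<^sup>k)\<close>, and \<open>S \<alpha>\<^sub>0\<close> maps \<open>ker (S \<alpha>)\<^sup>k\<close> onto itself.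
\<close>

lemma V_eq_ker_pow:
  assumes "Fin \<alpha>\<^sub>0 \<noteq> \<alpha>"
  shows "V F \<alpha>\<^sub>0 \<alpha> k = ops.ker_pow \<alpha> k"
proof (induction k)
  case 0
  show ?case by (cases \<alpha>) (simp_all add: ops.ker_pow_def)
next
  case (Suc k)
  have "b \<in> V F \<alpha>\<^sub>0 \<alpha> (Suc k) \<longleftrightarrow> b \<in> ops.ker_pow \<alpha> (Suc k)" for b
  proof -
    have "b \<in> V F \<alpha>\<^sub>0 \<alpha> (Suc k) \<longleftrightarrow> pencil_op \<alpha> b \<in> pencil_op (Fin \<alpha>\<^sub>0) ` ops.ker_pow \<alpha> k"
      by (auto simp: V_Suc_iff Suc.IH image_iff pencil_op_eq_iff)
    also have "pencil_op (Fin \<alpha>\<^sub>0) ` ops.ker_pow \<alpha> k = ops.ker_pow \<alpha> k"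
      using ops.S_ker_pow ops.S_surj_on_ker_pow[OF assms] by blast
    finally show ?thesis by (simp only: ops.ker_pow_Suc_iff)
  qed
  then show ?case by blast
qed

end

section \<open>The decomposition of the algebra\<close>

theorem theorem19:
  fixes scale :: "complex \<Rightarrow> 'a::ring \<Rightarrow> 'a"
    and F :: "'a \<Rightarrow> complex"
    and \<alpha>\<^sub>0 :: "xcomplex \<Rightarrow> complex"
  assumes "fd_complex_algebra scale"
    and "fd_complex_algebra.algebra_type1 scale"
    and "F \<in> fd_complex_algebra.dual scale"
    and "fd_complex_algebra.pair_type1 scale F"
    and "\<And>\<alpha>. Fin (\<alpha>\<^sub>0 \<alpha>) \<noteq> \<alpha>"
  shows "fd_complex_algebra.internal_direct_sum scale (\<lambda>\<alpha>. \<Union>k. V F (\<alpha>\<^sub>0 \<alpha>) \<alpha> k)"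
proof -
  interpret algebra_functional scale F
    using assms(1,3) by (simp add: algebra_functional_def algebra_functional_axioms_def)
  obtain e where e: "ordered_basis e" "char_form e F \<noteq> 0" using assms(4) unfolding pair_type1_def by blast
  obtain l m where lm: "l \<noteq> 0" "Polynomial.poly (Polynomial.poly (char_form e F) [:l:]) m \<noteq> 0"
    using nonzero_bivariate_poly_value[OF e(2)] by blast
  define \<gamma> where "\<gamma> = - m / l"
  interpret regular_functional scale F \<gamma>
    using e(1) lm pencil_unique_solution[of e l m]
    by unfold_locales (auto simp: ordered_basis_def poly_char_form \<gamma>_def)
  have "(\<Union>k. V F (\<alpha>\<^sub>0 \<alpha>) \<alpha> k) = ops.gen_ker \<alpha>" for \<alpha>
    by (simp add: ops.gen_ker_def V_eq_ker_pow[OF assms(5)])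
  then show ?thesis
    using ops.subspace_gen_ker ops.gen_ker_decomposition by (simp add: internal_direct_sum_def)
qed

end
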